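(* There exists an absolute constant $C>0$ such that the following holds. Fix $p\in[1,\infty]$, an integer $r\ge16$, $\sigma>0$, and set $T=2r$. Let $m\ge1$ and let $u_1,\dots,u_m\in\mathbb{R}^T$ be fixed (deterministic) inputs with $\|u_i\|_p\le1$ for all $i=1,\dots,m$. Let $\mathscr{H}_r$ denote the space of all length-$r$ FIR filters. Then $$ \inf_{\widehat G}\ \sup_{G\in\mathscr{H}_r}\ \mathbb{E}\,\|\widehat G-G\|_\infty\ \ge\ C\,\sigma\sqrt{\frac{r^{2/\max(p,2)}\log r}{m}}, $$ where the infimum ranges over all measurable functions $\widehat G:(\mathbb{R}^T)^m\to\mathscr{H}_r$ of the $m$ observations (and $2/\max(p,2)=0$ when $p=\infty$).
   Context: A length-$r$ FIR filter is $G(z)=\sum_{k=0}^{r-1}g_kz^{-k}$ with coefficient vector $g=(g_0,\dots,g_{r-1})\in\mathbb{R}^r$; $\mathscr{H}_r$ is the set of all of them. $\|G\|_\infty=\sup_{|z|=1}|G(z)|$ is the $\mathcal{H}_\infty$-norm. When the true system is $G$, the estimator is evaluated at the observations $(Y_1,\dots,Y_m)\in(\mathbb{R}^T)^m$, $Y_i=((g\ast u_i)_k)_{k=0}^{T-1}+\xi_i$, where $u_i$ is indexed by $0,\dots,T-1$ and $\xi_1,\dots,\xi_m$ are i.i.d. $N(0,\sigma^2I_T)$; the expectation is over the noise. *)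

theory Defs
  imports "HOL-Probability.Probability"
begin

text \<open>
  Vectors of \<open>\<real>\<^sup>n\<close> with varying \<open>n\<close> are functions \<open>nat \<Rightarrow> real\<close> of which only the values at
  \<open>0, \<dots>, n - 1\<close> matter; where the vectors form a measurable space, the carrier is
  \<open>{..<n} \<rightarrow>\<^sub>E UNIV\<close>, the space of the product measure space below.
\<close>

abbreviation borel_vec :: "nat \<Rightarrow> (nat \<Rightarrow> real) measure" where
  "borel_vec n \<equiv> PiM {..<n} (\<lambda>_. borel)"

definition lp_norm :: "ennreal \<Rightarrow> nat \<Rightarrow> (nat \<Rightarrow> real) \<Rightarrow> real" where
  "lp_norm p n x =
     (if p = \<infinity> then (SUP k\<in>{..<n}. \<bar>x k\<bar>)
      else (\<Sum>k<n. \<bar>x k\<bar> powr enn2real p) powr (1 / enn2real p))"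

text \<open>A length-\<open>r\<close> FIR filter is represented by its coefficient vector.\<close>

definition fir_filters :: "nat \<Rightarrow> (nat \<Rightarrow> real) set" where
  "fir_filters r = {..<r} \<rightarrow>\<^sub>E UNIV"

definition transfer_function :: "nat \<Rightarrow> (nat \<Rightarrow> real) \<Rightarrow> complex \<Rightarrow> complex" where
  "transfer_function r g z = (\<Sum>k<r. of_real (g k) * z powi (- int k))"

definition hinf_norm :: "nat \<Rightarrow> (nat \<Rightarrow> real) \<Rightarrow> real" where
  "hinf_norm r g = (SUP z\<in>{z. cmod z = 1}. cmod (transfer_function r g z))"

text \<open>
  Output at time \<open>k\<close>: since \<open>g\<close> vanishes outside \<open>{0..<r}\<close> and the input is zero before time \<open>0\<close>,
  the full convolution sum reduces to the indices \<open>j < r\<close> with \<open>j \<le> k\<close>.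
\<close>

definition fir_conv :: "nat \<Rightarrow> (nat \<Rightarrow> real) \<Rightarrow> (nat \<Rightarrow> real) \<Rightarrow> nat \<Rightarrow> real" where
  "fir_conv r g u k = (\<Sum>j\<in>{j. j < r \<and> j \<le> k}. g j * u (k - j))"

text \<open>The joint law of \<open>m\<close> independent \<open>N(0, \<sigma>\<^sup>2 I)\<close> vectors of length \<open>T\<close>.\<close>

definition noise_law :: "nat \<Rightarrow> nat \<Rightarrow> real \<Rightarrow> (nat \<Rightarrow> nat \<Rightarrow> real) measure" where
  "noise_law m T \<sigma> = PiM {1..m} (\<lambda>_. PiM {..<T} (\<lambda>_. density lborel (normal_density 0 \<sigma>)))"

definition observations ::
  "nat \<Rightarrow> nat \<Rightarrow> nat \<Rightarrow> (nat \<Rightarrow> nat \<Rightarrow> real) \<Rightarrow> (nat \<Rightarrow> real) \<Rightarrow> (nat \<Rightarrow> nat \<Rightarrow> real) \<Rightarrow> nat \<Rightarrow> nat \<Rightarrow> real"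
where
  "observations r m T u g \<xi> = (\<lambda>i\<in>{1..m}. \<lambda>k\<in>{..<T}. fir_conv r g (u i) k + \<xi> i k)"

definition estimators :: "nat \<Rightarrow> nat \<Rightarrow> nat \<Rightarrow> ((nat \<Rightarrow> nat \<Rightarrow> real) \<Rightarrow> nat \<Rightarrow> real) set" where
  "estimators r m T = PiM {1..m} (\<lambda>_. borel_vec T) \<rightarrow>\<^sub>M borel_vec r"

text \<open>
  The expected error may be infinite, so it is a nonnegative integral with values in
  \<^typ>\<open>ennreal\<close>.
\<close>

definition risk ::
  "nat \<Rightarrow> nat \<Rightarrow> nat \<Rightarrow> real \<Rightarrow> (nat \<Rightarrow> nat \<Rightarrow> real) \<Rightarrow>
   ((nat \<Rightarrow> nat \<Rightarrow> real) \<Rightarrow> nat \<Rightarrow> real) \<Rightarrow> (nat \<Rightarrow> real) \<Rightarrow> ennreal"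
where
  "risk r m T \<sigma> u Ghat g =
     (\<integral>\<^sup>+ \<xi>. ennreal (hinf_norm r (\<lambda>k. Ghat (observations r m T u g \<xi>) k - g k)) \<partial>noise_law m T \<sigma>)"

end

theory Submission
  imports Defs
begin

text \<open>
  The codewords are the sampled cosines \<open>g\<^sub>j(l) = \<tau> cos (2\<pi>jl/r)\<close> with \<open>1 \<le> j < r/2\<close>. The transfer
  function of \<open>g\<^sub>j\<close> equals \<open>\<tau>r/2\<close> at \<open>exp (2\<pi>ij/r)\<close> and vanishes at \<open>exp (2\<pi>il/r)\<close> for every other
  \<open>l\<close> in this range, so an estimator with small error identifies \<open>j\<close>, while by Parseval the energies
  of the outputs
  \<open>g\<^sub>j * u\<^sub>i\<close> are small on average over \<open>j\<close>. The events \<open>A\<^sub>j\<close> that the estimator is close to \<open>g\<^sub>j\<close>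
  are disjoint, hence for some \<open>j\<close> both the energy and the probability of \<open>A\<^sub>j\<close> under pure noise are
  small. The second moment of the likelihood ratio is the exponential of the energy over \<open>\<sigma>\<^sup>2\<close>, so
  \<open>A\<^sub>j\<close> also has probability at most \<open>4/5\<close> when the true filter is \<open>g\<^sub>j\<close>.
\<close>

section \<open>Orthogonality of the sampled cosines\<close>

text \<open>The sum is the real part of a geometric sum over powers of an \<open>r\<close>-th root
  of unity, and this root is not 1 because \<open>r\<close> does not divide
  \<open>q\<close>.\<close>

lemma sum_cos_multiples_eq_0:
  fixes q r :: nat
  assumes "0 < q" "q < r"
  shows "(\<Sum>k<r. cos (2 * pi * real q * real k / real r)) = 0"
proof -
  define a where "a = 2 * pi * real q / real r"
  have "cos a \<noteq> 1"
  proof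
    assume "cos a = 1"
    then obtain n :: int where "a = n * 2 * pi"
      by (auto simp: cos_one_2pi_int)
    then have "real q = n * real r"
      using assms by (simp add: a_def field_simps)
    then have "int q = n * int r"
      by (metis of_int_eq_iff of_int_mult of_int_of_nat_eq)
    then show False
      using assms by (metis dvd_triv_right of_nat_dvd_iff nat_dvd_not_less)
  qed
  then have "cis a \<noteq> 1"
    by (metis cis.simps(1) one_complex.simps(1))
  moreover have "cis a ^ r = 1"
  proof -
    have "real r * a = real q * (2 * pi)"
      using assms by (simp add: a_def)
    then have "cis a ^ r = cis (real q * (2 * pi))"
      by (simp only: Complex.DeMoivre)
    also have "\<dots> = cis (2 * pi) ^ q"
      by (rule Complex.DeMoivre[symmetric])
    finally show ?thesis
      by simp
  qed
  ultimately have "(\<Sum>k<r. cis a ^ k) = 0"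
    by (simp add: geometric_sum)
  then have "(\<Sum>k<r. Re (cis a ^ k)) = 0"
    by (metis Re_sum zero_complex.simps(1))
  then show ?thesis
    by (simp add: Complex.DeMoivre a_def field_simps)
qed

lemma sum_cos_diff_multiples:
  fixes l l' r :: nat
  assumes "l < r" "l' < r"
  shows "(\<Sum>j<r. cos (2 * pi * real j * real l / real r - 2 * pi * real j * real l' / real r)) =
           (if l = l' then real r else 0)"
proof -
  consider "l = l'" | "l < l'" | "l' < l" by linarith
  then show ?thesis
  proof cases
    case 2
    have "(\<Sum>j<r. cos (2 * pi * real j * real l / real r - 2 * pi * real j * real l' / real r)) =
          (\<Sum>j<r. cos (2 * pi * real (l' - l) * real j / real r))"
    proof (intro sum.cong refl)
      fix j
      have "2 * pi * real (l' - l) * real j / real r =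
            - (2 * pi * real j * real l / real r - 2 * pi * real j * real l' / real r)"
        using 2 by (simp add: of_nat_diff diff_divide_distrib algebra_simps)
      then show "cos (2 * pi * real j * real l / real r - 2 * pi * real j * real l' / real r) =
                 cos (2 * pi * real (l' - l) * real j / real r)"
        by (metis cos_minus)
    qed
    then show ?thesis
      using 2 assms sum_cos_multiples_eq_0[of "l' - l" r] by simp
  next
    case 3
    have "(\<Sum>j<r. cos (2 * pi * real j * real l / real r - 2 * pi * real j * real l' / real r)) =
          (\<Sum>j<r. cos (2 * pi * real (l - l') * real j / real r))"
      using 3 by (intro sum.cong refl) (simp add: of_nat_diff diff_divide_distrib algebra_simps)
    then show ?thesis
      using 3 assms sum_cos_multiples_eq_0[of "l - l'" r] by simp
  qed simp
qed

text \<open>Adding the squared sine sums gives the energy of the full discrete Fourier transform,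
  for which orthogonality over \<open>j\<close> turns the bound into an equality.\<close>

lemma cos_parseval_le:
  fixes v :: "nat \<Rightarrow> real"
  shows "(\<Sum>j<r. (\<Sum>l<r. v l * cos (2 * pi * real j * real l / real r))\<^sup>2) \<le> real r * (\<Sum>l<r. (v l)\<^sup>2)"
proof -
  define w where "w j l = 2 * pi * real j * real l / real r" for j l :: nat
  have "(\<Sum>j<r. (\<Sum>l<r. v l * cos (w j l))\<^sup>2)
      \<le> (\<Sum>j<r. (\<Sum>l<r. v l * cos (w j l))\<^sup>2 + (\<Sum>l<r. v l * sin (w j l))\<^sup>2)"
    by (intro sum_mono) simp
  also have "\<dots> = (\<Sum>j<r. \<Sum>l<r. \<Sum>l'<r. v l * v l' * cos (w j l - w j l'))"
    by (simp add: power2_eq_square sum_product sum.distrib[symmetric] cos_diff algebra_simps)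
  also have "\<dots> = (\<Sum>l<r. \<Sum>l'<r. v l * v l' * (\<Sum>j<r. cos (w j l - w j l')))"
    by (subst sum.swap, rule sum.cong[OF refl], subst sum.swap) (simp add: sum_distrib_left)
  also have "\<dots> = (\<Sum>l<r. \<Sum>l'<r. if l = l' then real r * (v l)\<^sup>2 else 0)"
    unfolding w_def by (intro sum.cong refl) (simp add: sum_cos_diff_multiples power2_eq_square)
  also have "\<dots> = real r * (\<Sum>l<r. (v l)\<^sup>2)"
    by (simp add: sum_distrib_left)
  finally show ?thesis
    by (simp add: w_def)
qed

text \<open>Product-to-sum formula. The condition \<open>j + n < r\<close> keeps the sum frequency
  from being a multiple of \<open>r\<close>; this is why the codewords use only frequencies below
  \<open>r / 2\<close>.\<close>

lemma sum_cos_cos_multiples: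
  fixes j n r :: nat
  assumes "1 \<le> j" "1 \<le> n" "j + n < r"
  shows "(\<Sum>k<r. cos (2 * pi * real j * real k / real r) * cos (2 * pi * real n * real k / real r)) =
           (if j = n then real r / 2 else 0)"
proof -
  have split: "(\<Sum>k<r. cos (2 * pi * real j * real k / real r) * cos (2 * pi * real n * real k / real r))
      = (\<Sum>k<r. cos (2 * pi * real k * real j / real r - 2 * pi * real k * real n / real r)) / 2
        + (\<Sum>k<r. cos (2 * pi * real (j + n) * real k / real r)) / 2"
    unfolding sum_divide_distrib sum.distrib[symmetric]
    by (intro sum.cong refl) (simp add: cos_times_cos field_simps)
  show ?thesis
    unfolding split using assms sum_cos_diff_multiples[of j r n] sum_cos_multiples_eq_0[of "j + n" r]
    by simp
qed

section \<open>Cosine functionals and output energies\<close>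

text \<open>The cosine sum is the real part of the transfer function at the point
  \<open>cis (2 * pi * real l / real r)\<close> of the unit circle.\<close>

lemma abs_cos_functional_le_hinf_norm:
  "\<bar>\<Sum>k<r. g k * cos (2 * pi * real l * real k / real r)\<bar> \<le> hinf_norm r g"
proof -
  define z where "z = cis (2 * pi * real l / real r)"
  have "cmod z = 1"
    by (simp add: z_def)
  \<comment> \<open>A real \<open>SUP\<close> is known to dominate its members only if they are
    bounded above; the sum of the absolute coefficients is such a bound.\<close>
  have "cmod (transfer_function r g y) \<le> (\<Sum>k<r. \<bar>g k\<bar>)" if "cmod y = 1" for y
    unfolding transfer_function_def
    by (rule norm_sum[THEN order_trans]) (simp add: norm_mult norm_power_int that)
  then have bdd: "bdd_above ((\<lambda>z. cmod (transfer_function r g z)) ` {z. cmod z = 1})"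
    by (intro bdd_aboveI2) auto
  have "Re (transfer_function r g z) = (\<Sum>k<r. g k * cos (2 * pi * real l * real k / real r))"
    by (simp add: transfer_function_def z_def cis_power_int)
       (simp add: algebra_simps)
  then have "\<bar>\<Sum>k<r. g k * cos (2 * pi * real l * real k / real r)\<bar> \<le> cmod (transfer_function r g z)"
    by (metis abs_Re_le_cmod)
  also have "\<dots> \<le> hinf_norm r g"
    unfolding hinf_norm_def using bdd \<open>cmod z = 1\<close> by (intro cSUP_upper) auto
  finally show ?thesis .
qed

text \<open>At a fixed time \<open>k\<close> the output is, as a function of \<open>j\<close>, a
  cosine transform of the last \<open>r\<close> inputs read backwards. Parseval over
  \<open>j\<close> gives one factor \<open>r\<close>; the other counts the \<open>r\<close> delayed
  copies of \<open>u\<close>, none of which has more energy than \<open>u\<close>.\<close>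

lemma sum_sq_fir_conv_cos_le:
  assumes g: "\<And>j l. j < r \<Longrightarrow> l < r \<Longrightarrow> g j l = \<tau> * cos (2 * pi * real j * real l / real r)"
  shows "(\<Sum>j<r. \<Sum>k<T. (fir_conv r (g j) u k)\<^sup>2) \<le> \<tau>\<^sup>2 * (real r)\<^sup>2 * (\<Sum>k<T. (u k)\<^sup>2)"
proof -
  define v where "v k l = (if l \<le> k then u (k - l) else 0)" for k l
  have conv: "fir_conv r (g j) u k = \<tau> * (\<Sum>l<r. v k l * cos (2 * pi * real j * real l / real r))"
    if "j < r" for j k
  proof -
    have "fir_conv r (g j) u k = (\<Sum>l\<in>{l. l < r \<and> l \<le> k}. g j l * v k l)"
      unfolding fir_conv_def by (intro sum.cong) (auto simp: v_def)
    also have "\<dots> = (\<Sum>l<r. g j l * v k l)"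
      by (intro sum.mono_neutral_left) (auto simp: v_def)
    finally show ?thesis
      using that by (simp add: g sum_distrib_left mult_ac)
  qed
  have shift: "(\<Sum>k<T. (v k l)\<^sup>2) \<le> (\<Sum>k<T. (u k)\<^sup>2)" for l
  proof -
    have "(\<Sum>k<T. (v k l)\<^sup>2) = (\<Sum>k\<in>{l..<T}. (u (k - l))\<^sup>2)"
      by (intro sum.mono_neutral_cong_right) (auto simp: v_def)
    also have "\<dots> = (\<Sum>k\<in>(\<lambda>k. k - l) ` {l..<T}. (u k)\<^sup>2)"
      by (subst sum.reindex) (auto simp: inj_on_def)
    also have "\<dots> \<le> (\<Sum>k<T. (u k)\<^sup>2)"
      by (intro sum_mono2) auto
    finally show ?thesis .
  qed
  have "(\<Sum>j<r. \<Sum>k<T. (fir_conv r (g j) u k)\<^sup>2)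
      = \<tau>\<^sup>2 * (\<Sum>k<T. \<Sum>j<r. (\<Sum>l<r. v k l * cos (2 * pi * real j * real l / real r))\<^sup>2)"
    unfolding sum_distrib_left[of "\<tau>\<^sup>2"]
    by (subst sum.swap, intro sum.cong refl) (simp add: conv power_mult_distrib)
  also have "\<dots> \<le> \<tau>\<^sup>2 * (\<Sum>k<T. real r * (\<Sum>l<r. (v k l)\<^sup>2))"
    by (intro mult_left_mono sum_mono cos_parseval_le) auto
  also have "(\<Sum>k<T. real r * (\<Sum>l<r. (v k l)\<^sup>2)) = real r * (\<Sum>l<r. \<Sum>k<T. (v k l)\<^sup>2)"
    by (subst sum.swap) (simp add: sum_distrib_left)
  also have "\<tau>\<^sup>2 * (real r * (\<Sum>l<r. \<Sum>k<T. (v k l)\<^sup>2)) \<le> \<tau>\<^sup>2 * (real r * (real r * (\<Sum>k<T. (u k)\<^sup>2)))"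
    using sum_bounded_above[of "{..<r}" "\<lambda>l. \<Sum>k<T. (v k l)\<^sup>2", OF shift]
    by (intro mult_left_mono) auto
  finally show ?thesis
    by (simp add: power2_eq_square mult_ac)
qed

section \<open>Input energy under the norm constraint\<close>

text \<open>For \<open>p\<close> at most 2 the exponent is 0, and entries bounded by 1 have squares
  below their \<open>p\<close>-th powers. For larger finite \<open>p\<close> this is Hoelder's
  inequality, and for \<open>p = \<infinity>\<close> the bound is \<open>T\<close>.\<close>

lemma sum_sq_le_of_lp_norm_le_1:
  assumes "1 \<le> p" "lp_norm p T x \<le> 1" "T > 0"
  shows "(\<Sum>k<T. (x k)\<^sup>2) \<le> real T powr (1 - enn2real (2 / max p 2))"
proof (cases "p = \<infinity>")
  case True
  have "\<bar>x k\<bar> \<le> 1" if "k < T" for k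
  proof -
    have "\<bar>x k\<bar> \<le> (SUP k\<in>{..<T}. \<bar>x k\<bar>)"
      using that by (intro cSUP_upper) auto
    then show ?thesis
      using assms(2) True by (simp add: lp_norm_def)
  qed
  then have "(\<Sum>k<T. (x k)\<^sup>2) \<le> (\<Sum>k<T. 1)"
    by (intro sum_mono) (simp add: abs_square_le_1)
  then show ?thesis
    using True \<open>T > 0\<close> by (simp add: max_def top_unique)
next
  case False
  define q where "q = enn2real p"
  have p: "p = ennreal q" "q \<ge> 1"
  proof -
    obtain q' where "p = ennreal q'" "q' \<ge> 0"
      using False by (cases p) auto
    then show "p = ennreal q" "q \<ge> 1"
      using assms(1) by (simp_all add: q_def)
  qed
  have pow: "(\<Sum>k<T. \<bar>x k\<bar> powr q) \<le> 1"
  proof (rule ccontr)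
    assume "\<not> ?thesis"
    then have "(\<Sum>k<T. \<bar>x k\<bar> powr q) powr (1 / q) > 1"
      using \<open>q \<ge> 1\<close> by (intro gr_one_powr) auto
    then show False
      using assms(2) False by (simp add: lp_norm_def q_def)
  qed
  show ?thesis
  proof (cases "q \<le> 2")
    case True
    then have "max p 2 = 2"
      using p(1) by (simp add: max_def ennreal_le_iff2[of q 2, simplified])
    then have e: "enn2real (2 / max p 2) = 1"
      by (simp add: ennreal_divide_self)
    have "\<bar>x k\<bar> \<le> 1" if "k < T" for k
    proof (rule ccontr)
      assume "\<not> ?thesis"
      then have "\<bar>x k\<bar> powr q > 1"
        using \<open>q \<ge> 1\<close> by (intro gr_one_powr) auto
      moreover have "\<bar>x k\<bar> powr q \<le> (\<Sum>k<T. \<bar>x k\<bar> powr q)"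
        using that by (intro member_le_sum) auto
      ultimately show False
        using pow by simp
    qed
    then have "(\<Sum>k<T. (x k)\<^sup>2) \<le> (\<Sum>k<T. \<bar>x k\<bar> powr q)"
    proof (intro sum_mono)
      fix k assume "k \<in> {..<T}" and le: "\<And>k. k < T \<Longrightarrow> \<bar>x k\<bar> \<le> 1"
      have "(x k)\<^sup>2 = \<bar>x k\<bar> powr 2"
        by (cases "x k = 0") (simp_all add: powr_numeral)
      also have "\<dots> \<le> \<bar>x k\<bar> powr q"
        using True le[of k] \<open>k \<in> {..<T}\<close> by (intro powr_mono') auto
      finally show "(x k)\<^sup>2 \<le> \<bar>x k\<bar> powr q" .
    qed
    then show ?thesis
      using pow e \<open>T > 0\<close> by simp
  next
    case False
    define \<theta> where "\<theta> = 2 / q"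
    have \<theta>: "0 < \<theta>" "\<theta> < 1"
      using False by (auto simp: \<theta>_def)
    have "max p 2 = ennreal q"
      using p(1) False by (simp add: max_def ennreal_le_iff2[of q 2, simplified])
    then have e: "enn2real (2 / max p 2) = \<theta>"
      using False divide_ennreal[of 2 q] by (simp add: \<theta>_def)
    \<comment> \<open>Weighted Young inequality with second factor 1. The scale \<open>T\<close> is
      chosen so that both terms, summed over \<open>k\<close>, contribute
      \<open>\<theta> * T\<close> and \<open>(1 - \<theta>) * T\<close> at most, hence
      \<open>T\<close> together.\<close>
    have young: "real T powr \<theta> * (x k)\<^sup>2 \<le> \<theta> * (real T * \<bar>x k\<bar> powr q) + (1 - \<theta>)" for k
    proof (cases "x k = 0")
      case True
      then show ?thesis
        using \<theta> by simp
    next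
      case False
      have "(real T * \<bar>x k\<bar> powr q) powr \<theta> = real T powr \<theta> * (x k)\<^sup>2"
        using \<open>\<not> q \<le> 2\<close> False by (simp add: powr_mult powr_powr \<theta>_def powr_numeral)
      then show ?thesis
        using Youngs_inequality_0[of \<theta> "1 - \<theta>" "real T * \<bar>x k\<bar> powr q" 1] \<theta> False \<open>T > 0\<close> by simp
    qed
    have "real T powr \<theta> * (\<Sum>k<T. (x k)\<^sup>2) \<le> (\<Sum>k<T. \<theta> * (real T * \<bar>x k\<bar> powr q) + (1 - \<theta>))"
      unfolding sum_distrib_left by (intro sum_mono young)
    also have "\<dots> = \<theta> * real T * (\<Sum>k<T. \<bar>x k\<bar> powr q) + (1 - \<theta>) * real T"
      by (simp add: sum.distrib sum_distrib_left mult_ac)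
    also have "\<dots> \<le> \<theta> * real T * 1 + (1 - \<theta>) * real T"
      using pow \<theta> by (intro add_right_mono mult_left_mono) auto
    also have "\<dots> = real T"
      by (simp add: algebra_simps)
    finally have "(\<Sum>k<T. (x k)\<^sup>2) \<le> real T / real T powr \<theta>"
      using \<open>T > 0\<close> by (simp add: field_simps)
    then show ?thesis
      using e \<open>T > 0\<close> by (simp add: powr_diff)
  qed
qed

section \<open>Change of measure for shifted Gaussian noise\<close>

text \<open>Both sides are the product of the measures \<open>density (M i) (L i)\<close>, which is
  determined by its values on boxes. The general factors \<open>M i\<close> allow two uses: over the
  times within one experiment, then over the experiments.\<close>

lemma distr_PiM_eq_density:
  assumes "finite I"
    and sf: "\<And>i. sigma_finite_measure (M i)"
    and sf': "\<And>i. sigma_finite_measure (density (M i) (L i))"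
    and S: "\<And>i. S i \<in> M i \<rightarrow>\<^sub>M M i"
    and L: "\<And>i. L i \<in> borel_measurable (M i)"
    and eq: "\<And>i. distr (M i) (M i) (S i) = density (M i) (L i)"
  shows "distr (PiM I M) (PiM I M) (\<lambda>x. \<lambda>i\<in>I. S i (x i)) = density (PiM I M) (\<lambda>x. \<Prod>i\<in>I. L i (x i))"
proof -
  interpret M: product_sigma_finite M
    using sf by (simp add: product_sigma_finite_def)
  interpret N: product_sigma_finite "\<lambda>i. density (M i) (L i)"
    using sf' by (simp add: product_sigma_finite_def)
  note [measurable] = S L
  have sets: "sets (PiM I M) = sets (PiM I (\<lambda>i. density (M i) (L i)))"
    by (intro sets_PiM_cong) auto
  have "distr (PiM I M) (PiM I M) (\<lambda>x. \<lambda>i\<in>I. S i (x i)) = PiM I (\<lambda>i. density (M i) (L i))"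
  proof (rule N.PiM_eqI[OF \<open>finite I\<close>])
    fix A assume "\<And>i. i \<in> I \<Longrightarrow> A i \<in> sets (density (M i) (L i))"
    then have A[measurable]: "\<And>i. i \<in> I \<Longrightarrow> A i \<in> sets (M i)"
      by simp
    have "(\<lambda>x. \<lambda>i\<in>I. S i (x i)) -` PiE I A \<inter> space (PiM I M)
        = (\<Pi>\<^sub>E i\<in>I. S i -` A i \<inter> space (M i))"
      by (auto simp: space_PiM PiE_iff)
    then have "emeasure (distr (PiM I M) (PiM I M) (\<lambda>x. \<lambda>i\<in>I. S i (x i))) (PiE I A)
        = emeasure (PiM I M) (\<Pi>\<^sub>E i\<in>I. S i -` A i \<inter> space (M i))"
      using \<open>finite I\<close> A by (subst emeasure_distr) (auto intro!: sets_PiM_I_finite)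
    also have "\<dots> = (\<Prod>i\<in>I. emeasure (M i) (S i -` A i \<inter> space (M i)))"
      using \<open>finite I\<close> A S by (intro M.emeasure_PiM) auto
    also have "\<dots> = (\<Prod>i\<in>I. emeasure (density (M i) (L i)) (A i))"
      by (intro prod.cong refl) (simp add: eq[symmetric] emeasure_distr[OF S A])
    finally show "emeasure (distr (PiM I M) (PiM I M) (\<lambda>x. \<lambda>i\<in>I. S i (x i))) (PiE I A)
        = (\<Prod>i\<in>I. emeasure (density (M i) (L i)) (A i))" .
  qed (simp add: sets)
  moreover have "density (PiM I M) (\<lambda>x. \<Prod>i\<in>I. L i (x i)) = PiM I (\<lambda>i. density (M i) (L i))"
  proof (rule N.PiM_eqI[OF \<open>finite I\<close>])
    fix A assume "\<And>i. i \<in> I \<Longrightarrow> A i \<in> sets (density (M i) (L i))"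
    then have A[measurable]: "\<And>i. i \<in> I \<Longrightarrow> A i \<in> sets (M i)"
      by simp
    have ind: "indicator (PiE I A) x = (\<Prod>i\<in>I. indicator (A i) (x i) :: ennreal)"
      if "x \<in> space (PiM I M)" for x
      using that \<open>finite I\<close> by (auto simp: space_PiM PiE_iff indicator_def prod_zero_iff)
    have "emeasure (density (PiM I M) (\<lambda>x. \<Prod>i\<in>I. L i (x i))) (PiE I A)
        = (\<integral>\<^sup>+ x. (\<Prod>i\<in>I. L i (x i)) * indicator (PiE I A) x \<partial>PiM I M)"
      using \<open>finite I\<close> A by (intro emeasure_density) (auto intro!: sets_PiM_I_finite)
    also have "\<dots> = (\<integral>\<^sup>+ x. (\<Prod>i\<in>I. L i (x i) * indicator (A i) (x i)) \<partial>PiM I M)"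
      by (intro nn_integral_cong) (simp add: ind prod.distrib)
    also have "\<dots> = (\<Prod>i\<in>I. \<integral>\<^sup>+ x. L i x * indicator (A i) x \<partial>M i)"
      using \<open>finite I\<close> by (intro M.product_nn_integral_prod) auto
    also have "\<dots> = (\<Prod>i\<in>I. emeasure (density (M i) (L i)) (A i))"
      by (intro prod.cong refl) (simp add: emeasure_density)
    finally show "emeasure (density (PiM I M) (\<lambda>x. \<Prod>i\<in>I. L i (x i))) (PiE I A)
        = (\<Prod>i\<in>I. emeasure (density (M i) (L i)) (A i))" .
  qed (simp add: sets)
  ultimately show ?thesis
    by simp
qed

text \<open>The likelihood ratio of the normal law with mean \<open>h\<close> against the one with
  mean 0, both with standard deviation \<open>\<sigma>\<close>.\<close>

definition gauss_ratio :: "real \<Rightarrow> real \<Rightarrow> real \<Rightarrow> ennreal" where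
  "gauss_ratio \<sigma> h y = ennreal (exp ((h * y - h\<^sup>2 / 2) / \<sigma>\<^sup>2))"

lemma borel_measurable_gauss_ratio [measurable]: "gauss_ratio \<sigma> h \<in> borel_measurable borel"
  unfolding gauss_ratio_def by measurable

lemma normal_density_mult_gauss_ratio:
  assumes "\<sigma> > 0"
  shows "ennreal (normal_density 0 \<sigma> y) * gauss_ratio \<sigma> h y = ennreal (normal_density 0 \<sigma> (y - h))"
proof -
  have "exp (- (y\<^sup>2) / (2 * \<sigma>\<^sup>2)) * exp ((h * y - h\<^sup>2 / 2) / \<sigma>\<^sup>2) = exp (- ((y - h)\<^sup>2) / (2 * \<sigma>\<^sup>2))"
    unfolding exp_add[symmetric] using assms
    by (simp add: field_simps power2_eq_square)
  then show ?thesis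
    by (simp add: normal_density_def gauss_ratio_def ennreal_mult[symmetric])
qed

text \<open>The square is a constant times the ratio for the doubled mean, so the second moment can
  be read off without a new Gaussian integral.\<close>

lemma gauss_ratio_squared:
  "(gauss_ratio \<sigma> h y)\<^sup>2 = ennreal (exp (h\<^sup>2 / \<sigma>\<^sup>2)) * gauss_ratio \<sigma> (2 * h) y"
proof -
  have "2 * ((h * y - h\<^sup>2 / 2) / \<sigma>\<^sup>2) = h\<^sup>2 / \<sigma>\<^sup>2 + (2 * h * y - (2 * h)\<^sup>2 / 2) / \<sigma>\<^sup>2"
    by (simp add: power2_eq_square algebra_simps add_divide_distrib diff_divide_distrib)
  then show ?thesis
    by (simp add: gauss_ratio_def ennreal_mult[symmetric] ennreal_power exp_double[symmetric] exp_add[symmetric])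
qed

text \<open>Translation invariance of Lebesgue measure moves the shift from the argument of the set
  to that of the density.\<close>

lemma distr_shift_normal:
  assumes "\<sigma> > 0"
  defines "N \<equiv> density lborel (normal_density 0 \<sigma>)"
  shows "distr N N (\<lambda>y. h + y) = density N (gauss_ratio \<sigma> h)"
proof (rule measure_eqI)
  fix A assume "A \<in> sets (distr N N (\<lambda>y. h + y))"
  then have [measurable]: "A \<in> sets borel"
    by (simp add: N_def)
  have "emeasure (distr N N (\<lambda>y. h + y)) A = (\<integral>\<^sup>+ y. indicator A y \<partial>distr N N (\<lambda>y. h + y))"
    by (subst nn_integral_indicator) (auto simp: N_def)
  also have "\<dots> = (\<integral>\<^sup>+ y. indicator A (h + y) \<partial>N)"
    by (subst nn_integral_distr) (auto simp: N_def)
  also have "\<dots> = (\<integral>\<^sup>+ y. ennreal (normal_density 0 \<sigma> y) * indicator A (h + y) \<partial>lborel)"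
    unfolding N_def by (subst nn_integral_density) auto
  also have "\<dots> = (\<integral>\<^sup>+ y. ennreal (normal_density 0 \<sigma> (y - h)) * indicator A y \<partial>lborel)"
    by (subst nn_integral_real_affine[where c = 1 and t = "- h"]) auto
  also have "\<dots> = (\<integral>\<^sup>+ y. ennreal (normal_density 0 \<sigma> y) * (gauss_ratio \<sigma> h y * indicator A y) \<partial>lborel)"
    using assms by (simp add: normal_density_mult_gauss_ratio[symmetric] mult.assoc)
  also have "\<dots> = (\<integral>\<^sup>+ y. gauss_ratio \<sigma> h y * indicator A y \<partial>N)"
    unfolding N_def by (subst nn_integral_density) auto
  also have "\<dots> = emeasure (density N (gauss_ratio \<sigma> h)) A"
    by (subst emeasure_density) (auto simp: N_def)
  finally show "emeasure (distr N N (\<lambda>y. h + y)) A = emeasure (density N (gauss_ratio \<sigma> h)) A" .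
qed simp

text \<open>The ratio for mean \<open>2 * h\<close> is the density of a probability measure and
  integrates to 1; only the constant factor of the square remains.\<close>

lemma nn_integral_gauss_ratio_squared:
  assumes "\<sigma> > 0"
  shows "(\<integral>\<^sup>+ y. (gauss_ratio \<sigma> h y)\<^sup>2 \<partial>density lborel (normal_density 0 \<sigma>)) = ennreal (exp (h\<^sup>2 / \<sigma>\<^sup>2))"
proof -
  define N where "N = density lborel (normal_density 0 \<sigma>)"
  interpret prob_space N
    unfolding N_def by (rule prob_space_normal_density) fact
  have "(\<integral>\<^sup>+ y. gauss_ratio \<sigma> (2 * h) y \<partial>N) = emeasure (density N (gauss_ratio \<sigma> (2 * h))) (space N)"
    by (subst emeasure_density) (auto simp: N_def)
  also have "\<dots> = emeasure N ((\<lambda>y. 2 * h + y) -` space N \<inter> space N)"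
    unfolding N_def distr_shift_normal[OF assms, symmetric] by (subst emeasure_distr) auto
  also have "\<dots> = 1"
    by (simp add: N_def emeasure_space_1[unfolded N_def, simplified])
  finally have "(\<integral>\<^sup>+ y. gauss_ratio \<sigma> (2 * h) y \<partial>N) = 1" .
  then show ?thesis
    unfolding N_def by (simp add: gauss_ratio_squared nn_integral_cmult)
qed

text \<open>The likelihood ratio of the observations with noiseless outputs \<open>h\<close> against
  pure noise.\<close>

definition noise_ratio :: "nat \<Rightarrow> nat \<Rightarrow> real \<Rightarrow> (nat \<Rightarrow> nat \<Rightarrow> real) \<Rightarrow> (nat \<Rightarrow> nat \<Rightarrow> real) \<Rightarrow> ennreal" where
  "noise_ratio m T \<sigma> h y = (\<Prod>i\<in>{1..m}. \<Prod>k<T. gauss_ratio \<sigma> (h i k) (y i k))"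

context
  fixes T :: nat and \<sigma> :: real
  assumes \<sigma>: "\<sigma> > 0"
begin

abbreviation "noise1 \<equiv> density lborel (normal_density 0 \<sigma>)"
abbreviation "noiseT \<equiv> PiM {..<T} (\<lambda>_. noise1)"

lemma prob_space_noise1: "prob_space noise1"
  by (rule prob_space_normal_density[OF \<sigma>])

lemma prob_space_noiseT: "prob_space noiseT"
  by (intro prob_space_PiM prob_space_noise1)

lemma prob_space_noise_law: "prob_space (noise_law m T \<sigma>)"
  unfolding noise_law_def by (intro prob_space_PiM prob_space_noiseT)

lemma sets_noise_law: "sets (noise_law m T \<sigma>) = sets (PiM {1..m} (\<lambda>_. borel_vec T))"
  unfolding noise_law_def by (intro sets_PiM_cong refl) simp

lemma distr_shift_noiseT:
  "distr noiseT noiseT (\<lambda>y. \<lambda>k\<in>{..<T}. h k + y k) = density noiseT (\<lambda>y. \<Prod>k<T. gauss_ratio \<sigma> (h k) (y k))"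
proof (rule distr_PiM_eq_density)
  \<comment> \<open>The density is recognised as the law of a shifted normal variable, so it is a
    probability measure.\<close>
  show "sigma_finite_measure (density noise1 (gauss_ratio \<sigma> (h i)))" for i
    unfolding distr_shift_normal[OF \<sigma>, symmetric]
    by (intro prob_space_imp_sigma_finite prob_space.prob_space_distr prob_space_noise1) simp
qed (auto simp: distr_shift_normal[OF \<sigma>] intro: prob_space_imp_sigma_finite prob_space_noise1)

lemma borel_measurable_prod_gauss_ratio [measurable]:
  "(\<lambda>y. \<Prod>k<T. gauss_ratio \<sigma> (h k) (y k)) \<in> borel_measurable noiseT"
  by measurable

lemma borel_measurable_noise_ratio [measurable]:
  "noise_ratio m T \<sigma> h \<in> borel_measurable (noise_law m T \<sigma>)"
  unfolding noise_ratio_def noise_law_def by measurable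

lemma measurable_shift_noise_law:
  "(\<lambda>y. \<lambda>i\<in>{1..m}. \<lambda>k\<in>{..<T}. h i k + y i k) \<in> noise_law m T \<sigma> \<rightarrow>\<^sub>M noise_law m T \<sigma>"
  unfolding noise_law_def
proof (rule measurable_restrict)
  fix i assume "i \<in> {1..m}"
  then have "(\<lambda>y. y i) \<in> PiM {1..m} (\<lambda>_. noiseT) \<rightarrow>\<^sub>M noiseT"
    by (rule measurable_component_singleton)
  moreover have "(\<lambda>z. \<lambda>k\<in>{..<T}. h i k + z k) \<in> noiseT \<rightarrow>\<^sub>M noiseT"
    by measurable
  ultimately show "(\<lambda>y. \<lambda>k\<in>{..<T}. h i k + y i k) \<in> PiM {1..m} (\<lambda>_. noiseT) \<rightarrow>\<^sub>M noiseT"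
    by (rule measurable_compose)
qed

lemma distr_shift_noise_law:
  "distr (noise_law m T \<sigma>) (noise_law m T \<sigma>) (\<lambda>y. \<lambda>i\<in>{1..m}. \<lambda>k\<in>{..<T}. h i k + y i k)
     = density (noise_law m T \<sigma>) (noise_ratio m T \<sigma> h)"
  unfolding noise_law_def noise_ratio_def
proof (rule distr_PiM_eq_density)
  have m: "(\<lambda>y. \<lambda>k\<in>{..<T}. h i k + y k) \<in> noiseT \<rightarrow>\<^sub>M noiseT" for i
    by measurable
  then show "(\<lambda>y. \<lambda>k\<in>{..<T}. h i k + y k) \<in> noiseT \<rightarrow>\<^sub>M noiseT" for i .
  show "sigma_finite_measure (density noiseT (\<lambda>y. \<Prod>k<T. gauss_ratio \<sigma> (h i k) (y k)))" for i
    unfolding distr_shift_noiseT[symmetric]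
    by (intro prob_space_imp_sigma_finite prob_space.prob_space_distr prob_space_noiseT m)
  show "distr noiseT noiseT (\<lambda>y. \<lambda>k\<in>{..<T}. h i k + y k) =
      density noiseT (\<lambda>y. \<Prod>k<T. gauss_ratio \<sigma> (h i k) (y k))" for i
    by (rule distr_shift_noiseT)
qed (auto intro: prob_space_imp_sigma_finite prob_space_noiseT)

text \<open>Independence factors the second moment over experiments and times, and the exponents add
  up to the total output energy.\<close>

lemma nn_integral_noise_ratio_squared:
  "(\<integral>\<^sup>+ y. (noise_ratio m T \<sigma> h y)\<^sup>2 \<partial>noise_law m T \<sigma>)
     = ennreal (exp ((\<Sum>i\<in>{1..m}. \<Sum>k<T. (h i k)\<^sup>2) / \<sigma>\<^sup>2))"
proof -
  interpret product_sigma_finite "\<lambda>_::nat. noise1"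
    by (simp add: product_sigma_finite_def prob_space_imp_sigma_finite prob_space_noise1)
  interpret T: product_sigma_finite "\<lambda>_::nat. noiseT"
    by (simp add: product_sigma_finite_def prob_space_imp_sigma_finite prob_space_noiseT)
  have "(\<integral>\<^sup>+ y. (noise_ratio m T \<sigma> h y)\<^sup>2 \<partial>noise_law m T \<sigma>)
      = (\<Prod>i\<in>{1..m}. \<integral>\<^sup>+ y. (\<Prod>k<T. gauss_ratio \<sigma> (h i k) (y k))\<^sup>2 \<partial>noiseT)"
    unfolding noise_ratio_def noise_law_def prod_power_distrib[of _ "{1..m}"]
    by (rule T.product_nn_integral_prod[where f = "\<lambda>i y. (\<Prod>k<T. gauss_ratio \<sigma> (h i k) (y k))\<^sup>2"])
       (auto intro: borel_measurable_power)
  also have "\<dots> = (\<Prod>i\<in>{1..m}. \<Prod>k<T. \<integral>\<^sup>+ y. (gauss_ratio \<sigma> (h i k) y)\<^sup>2 \<partial>noise1)"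
    unfolding prod_power_distrib[of _ "{..<T}"]
  proof (intro prod.cong refl)
    fix i
    show "(\<integral>\<^sup>+ y. (\<Prod>k<T. (gauss_ratio \<sigma> (h i k) (y k))\<^sup>2) \<partial>noiseT)
        = (\<Prod>k<T. \<integral>\<^sup>+ y. (gauss_ratio \<sigma> (h i k) y)\<^sup>2 \<partial>noise1)"
      by (rule product_nn_integral_prod[where f = "\<lambda>k y. (gauss_ratio \<sigma> (h i k) y)\<^sup>2"]) auto
  qed
  also have "\<dots> = ennreal (exp ((\<Sum>i\<in>{1..m}. \<Sum>k<T. (h i k)\<^sup>2) / \<sigma>\<^sup>2))"
    by (simp add: nn_integral_gauss_ratio_squared[OF \<sigma>] prod_ennreal exp_sum[symmetric] prod_nonneg sum_divide_distrib)
  finally show ?thesis .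
qed

text \<open>The likelihood ratio \<open>L\<close> satisfies
  \<open>L \<le> a / 2 + L^2 / (2 * a)\<close> pointwise; integrating over \<open>A\<close> gives
  the bound. The parameter \<open>a\<close> is free, to balance the two terms later.\<close>

lemma emeasure_shift_noise_law_le:
  assumes A: "A \<in> sets (noise_law m T \<sigma>)" and a: "a > 0"
  shows "emeasure (distr (noise_law m T \<sigma>) (noise_law m T \<sigma>) (\<lambda>y. \<lambda>i\<in>{1..m}. \<lambda>k\<in>{..<T}. h i k + y i k)) A
    \<le> ennreal (a / 2) * emeasure (noise_law m T \<sigma>) A
      + ennreal (exp ((\<Sum>i\<in>{1..m}. \<Sum>k<T. (h i k)\<^sup>2) / \<sigma>\<^sup>2) / (2 * a))"
proof -
  note [measurable] = A
  let ?N = "noise_law m T \<sigma>"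
  let ?L = "noise_ratio m T \<sigma> h"
  have L: "?L y * indicator A y \<le> ennreal (a / 2) * indicator A y + ennreal (1 / (2 * a)) * (?L y)\<^sup>2" for y
  proof -
    obtain b where b: "?L y = ennreal b" "b \<ge> 0"
    proof
      show "?L y = ennreal (\<Prod>i\<in>{1..m}. \<Prod>k<T. exp ((h i k * y i k - (h i k)\<^sup>2 / 2) / \<sigma>\<^sup>2))"
        by (simp add: noise_ratio_def gauss_ratio_def prod_ennreal prod_nonneg)
    qed (simp add: prod_nonneg)
    have "0 \<le> (b - a)\<^sup>2 / (2 * a)"
      using a by simp
  also have "\<dots> = a / 2 + 1 / (2 * a) * b\<^sup>2 - b"
      using a by (simp add: field_simps power2_eq_square)
    finally have "ennreal b \<le> ennreal (a / 2) + ennreal (1 / (2 * a)) * (ennreal b)\<^sup>2"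
      using a b by (simp add: ennreal_power ennreal_mult[symmetric] ennreal_plus[symmetric] del: ennreal_plus)
    then show ?thesis
      by (simp add: b indicator_def)
  qed
  have "emeasure (density ?N ?L) A = (\<integral>\<^sup>+ y. ?L y * indicator A y \<partial>?N)"
    by (rule emeasure_density) measurable
  also have "\<dots> \<le> (\<integral>\<^sup>+ y. ennreal (a / 2) * indicator A y + ennreal (1 / (2 * a)) * (?L y)\<^sup>2 \<partial>?N)"
    by (intro nn_integral_mono L)
  also have "\<dots> = ennreal (a / 2) * emeasure ?N A + ennreal (1 / (2 * a)) * (\<integral>\<^sup>+ y. (?L y)\<^sup>2 \<partial>?N)"
    by (subst nn_integral_add) (auto simp: nn_integral_cmult)
  finally show ?thesis
    unfolding distr_shift_noise_law using a by (simp add: nn_integral_noise_ratio_squared ennreal_mult[symmetric])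
qed

end

section \<open>The lower bound for a given estimator\<close>

text \<open>The hypothesis \<open>small\<close> limits the amplitude \<open>\<tau>\<close> so that
  some codeword has output energy over \<open>\<sigma>^2\<close> at most \<open>ln r / 4\<close>,
  while the separation of the codewords is of order \<open>\<tau> * r\<close>.\<close>

lemma exists_filter_risk_ge:
  assumes r: "16 \<le> r" and \<sigma>: "0 < \<sigma>" and \<tau>: "0 < \<tau>" and m: "1 \<le> m" and "0 < S"
    and u: "\<And>i. i \<in> {1..m} \<Longrightarrow> (\<Sum>k<T. (u i k)\<^sup>2) \<le> S"
    and small: "5 * (real m * \<tau>\<^sup>2 * real r * S / \<sigma>\<^sup>2) \<le> ln (real r) / 4"
    and Ghat: "Ghat \<in> estimators r m T"
  shows "\<exists>g\<in>fir_filters r. ennreal (\<tau> * real r / 20) \<le> risk r m T \<sigma> u Ghat g"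
proof -
  define N where "N = noise_law m T \<sigma>"
  \<comment> \<open>The largest \<open>n\<close> with \<open>2 * n < r\<close>, so that two
    frequencies up to \<open>n\<close> always add to less than \<open>r\<close>.\<close>
  define n where "n = (r - 1) div 2"
  define g where "g j = (\<lambda>l\<in>{..<r}. \<tau> * cos (2 * pi * real j * real l / real r))" for j
  define R where "R l x = (\<Sum>k<r. x k * cos (2 * pi * real l * real k / real r))" for l and x :: "nat \<Rightarrow> real"
  \<comment> \<open>Closeness is tested by finitely many cosine functionals, which makes
    \<open>A j\<close> measurable. The radius is half of the gap \<open>\<tau> * r / 2\<close>
    between codewords, which makes these events disjoint.\<close>
  define A where "A j = {y \<in> space N. \<forall>l\<in>{1..n}. \<bar>R l (Ghat y) - R l (g j)\<bar> < \<tau> * real r / 4}" for j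
  define D where "D j = (\<Sum>i\<in>{1..m}. \<Sum>k<T. (fir_conv r (g j) (u i) k)\<^sup>2) / \<sigma>\<^sup>2" for j
  define B where "B = real m * \<tau>\<^sup>2 * (real r)\<^sup>2 * S / \<sigma>\<^sup>2"
  interpret N: prob_space N
    unfolding N_def by (rule prob_space_noise_law[OF \<sigma>])
  have n: "7 * real r \<le> 16 * real n" "n \<ge> 7" "2 * n < r"
    using r unfolding n_def by linarith+
  have "B > 0"
    using assms by (simp add: B_def)

  have Rg: "R l (g j) = (if j = l then \<tau> * real r / 2 else 0)" if "j \<in> {1..n}" "l \<in> {1..n}" for j l
  proof -
    have "R l (g j) = \<tau> * (\<Sum>k<r. cos (2 * pi * real j * real k / real r) * cos (2 * pi * real l * real k / real r))"
      by (simp add: R_def g_def sum_distrib_left mult_ac)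
    then show ?thesis
      using that n sum_cos_cos_multiples[of j l r] by simp
  qed

  have G: "Ghat \<in> N \<rightarrow>\<^sub>M borel_vec r"
    using Ghat measurable_cong_sets[OF sets_noise_law[OF \<sigma>] refl] by (auto simp: estimators_def N_def)
  have "(\<lambda>y. Ghat y k) \<in> borel_measurable N" if "k < r" for k
    by (rule measurable_compose[OF G measurable_component_singleton]) (simp add: that)
  then have [measurable]: "(\<lambda>y. R l (Ghat y)) \<in> borel_measurable N" for l
    unfolding R_def by (intro borel_measurable_sum borel_measurable_times borel_measurable_const) simp
  have A[measurable]: "A j \<in> sets N" for j
    unfolding A_def by measurable

  have "disjoint_family_on A {1..n}"
    unfolding disjoint_family_on_def
  proof (intro ballI impI)
    fix j l assume jl: "j \<in> {1..n}" "l \<in> {1..n}" "j \<noteq> l"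
    show "A j \<inter> A l = {}"
    proof (rule equals0I)
      fix y assume "y \<in> A j \<inter> A l"
      then have "\<bar>R j (Ghat y) - R j (g j)\<bar> < \<tau> * real r / 4" "\<bar>R j (Ghat y) - R j (g l)\<bar> < \<tau> * real r / 4"
        using jl by (auto simp: A_def)
      then show False
        using jl by (simp add: Rg abs_less_iff)
    qed
  qed
  then have "(\<Sum>j\<in>{1..n}. measure N (A j)) = measure N (\<Union>j\<in>{1..n}. A j)"
    by (intro N.finite_measure_finite_Union[symmetric]) auto
  then have sumA: "(\<Sum>j\<in>{1..n}. measure N (A j)) \<le> 1"
    by simp

  have sumD: "(\<Sum>j\<in>{1..n}. D j) \<le> B"
  proof -
    \<comment> \<open>Parseval is available for the full set of \<open>r\<close>
      frequencies.\<close>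
    have "(\<Sum>j\<in>{1..n}. D j) \<le> (\<Sum>j<r. D j)"
      using n by (intro sum_mono2) (auto simp: D_def intro!: divide_nonneg_nonneg sum_nonneg)
    also have "\<dots> = (\<Sum>i\<in>{1..m}. \<Sum>j<r. \<Sum>k<T. (fir_conv r (g j) (u i) k)\<^sup>2) / \<sigma>\<^sup>2"
      unfolding D_def sum_divide_distrib[symmetric] by (subst sum.swap) simp
    also have "\<dots> \<le> (\<Sum>i\<in>{1..m}. \<tau>\<^sup>2 * (real r)\<^sup>2 * S) / \<sigma>\<^sup>2"
    proof (intro divide_right_mono sum_mono)
      fix i assume "i \<in> {1..m}"
      then have "\<tau>\<^sup>2 * (real r)\<^sup>2 * (\<Sum>k<T. (u i k)\<^sup>2) \<le> \<tau>\<^sup>2 * (real r)\<^sup>2 * S"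
        by (intro mult_left_mono u) auto
      then show "(\<Sum>j<r. \<Sum>k<T. (fir_conv r (g j) (u i) k)\<^sup>2) \<le> \<tau>\<^sup>2 * (real r)\<^sup>2 * S"
        using sum_sq_fir_conv_cos_le[where g = g and r = r and \<tau> = \<tau> and T = T and u = "u i"]
        by (simp add: g_def)
    qed simp
    finally show ?thesis
      by (simp add: B_def)
  qed

  \<comment> \<open>Averaging: the probabilities sum to at most 1 and so do the
    \<open>D j / B\<close>. One index with their sum at most \<open>2 / n\<close> controls both, as
    both are nonnegative.\<close>
  obtain j where j: "j \<in> {1..n}" "measure N (A j) + D j / B \<le> 2 / real n"
  proof (rule ccontr)
    assume "\<not> thesis"
    then have "2 / real n < measure N (A j) + D j / B" if "j \<in> {1..n}" for j
      using that \<open>\<And>j. j \<in> {1..n} \<Longrightarrow> measure N (A j) + D j / B \<le> 2 / real n \<Longrightarrow> thesis\<close> by force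
    then have "(\<Sum>j\<in>{1..n}. 2 / real n) < (\<Sum>j\<in>{1..n}. measure N (A j) + D j / B)"
      using n by (intro sum_strict_mono) auto
    also have "\<dots> \<le> 1 + B / B"
      unfolding sum.distrib sum_divide_distrib[symmetric]
      using sumA sumD \<open>B > 0\<close> by (intro add_mono divide_right_mono) auto
    finally show False
      using n \<open>B > 0\<close> by simp
  qed
  have "D j \<ge> 0"
    by (auto simp: D_def intro!: divide_nonneg_nonneg sum_nonneg)
  then have mA: "measure N (A j) \<le> 2 / real n" and "D j / B \<le> 2 / real n"
    using j(2) \<open>B > 0\<close> measure_nonneg[of N "A j"] divide_nonneg_pos[of "D j" B] by linarith+
  then have "D j \<le> 2 / real n * B"
    using \<open>B > 0\<close> by (simp add: pos_divide_le_eq)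
  \<comment> \<open>From \<open>7 * r \<le> 16 * n\<close> follows
    \<open>2 / n \<le> 32 / (7 * r)\<close>, which is below \<open>5 / r\<close>; this is the factor
    5 in \<open>small\<close>.\<close>
  also have "\<dots> \<le> 5 / real r * B"
    using n r \<open>B > 0\<close> by (intro mult_right_mono) (auto simp: field_simps)
  also have "\<dots> = 5 * (real m * \<tau>\<^sup>2 * real r * S / \<sigma>\<^sup>2)"
    using r by (simp add: B_def power2_eq_square)
  also note small
  finally have Dj: "D j \<le> ln (real r) / 4" .

  \<comment> \<open>The map from noise to observations under \<open>g j\<close>;
    \<open>distr N N sh\<close> is the law of the data.\<close>
  define sh where "sh = (\<lambda>y::nat \<Rightarrow> nat \<Rightarrow> real. \<lambda>i\<in>{1..m}. \<lambda>k\<in>{..<T}. fir_conv r (g j) (u i) k + y i k)"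
  have sh: "sh \<in> N \<rightarrow>\<^sub>M N"
    unfolding sh_def N_def by (rule measurable_shift_noise_law[OF \<sigma>])
  interpret Q: prob_space "distr N N sh"
    by (rule N.prob_space_distr[OF sh])
  \<comment> \<open>The fourth root of \<open>r\<close>: it bounds \<open>exp (D j)\<close>, and it
    is at least 2 exactly because \<open>r\<close> is at least 16.\<close>
  define s where "s = exp (ln (real r) / 4)"
  have "s ^ 4 = real r"
    using r by (simp add: s_def exp_of_nat_mult[symmetric])
  have "s \<ge> 2"
  proof (rule ccontr)
    assume "\<not> s \<ge> 2"
    then have "s ^ 4 < 2 ^ 4"
      by (intro power_strict_mono) (auto simp: s_def)
    then show False
      using \<open>s ^ 4 = real r\<close> r by simp
  qed
  \<comment> \<open>The choice \<open>a = s^2 / 2\<close> leaves a first term of order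
    \<open>s^2 / n\<close>, hence of order \<open>1 / s^2\<close>, and a second term of at most
    \<open>1 / s\<close>.\<close>
  have "emeasure (distr N N sh) (A j)
      \<le> ennreal (s\<^sup>2 / 2 / 2) * emeasure N (A j) + ennreal (exp (D j) / (2 * (s\<^sup>2 / 2)))"
    unfolding N_def sh_def D_def
    using A \<open>s \<ge> 2\<close> by (intro emeasure_shift_noise_law_le \<sigma>) (auto simp: N_def)
  also have "\<dots> = ennreal (s\<^sup>2 / 4 * measure N (A j) + exp (D j) / s\<^sup>2)"
    by (simp add: N.emeasure_eq_measure ennreal_mult[symmetric] ennreal_plus[symmetric] del: ennreal_plus)
  finally have "measure (distr N N sh) (A j) \<le> s\<^sup>2 / 4 * measure N (A j) + exp (D j) / s\<^sup>2"
    by (simp add: Q.emeasure_eq_measure del: ennreal_plus)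
  also have "\<dots> \<le> s\<^sup>2 / 4 * (2 / real n) + s / s\<^sup>2"
    using mA Dj by (intro add_mono mult_left_mono divide_right_mono) (auto simp: s_def)
  also have "\<dots> \<le> 2 / 7 + 1 / 2"
  proof (rule add_mono)
    have "7 * (s\<^sup>2 * s\<^sup>2) \<le> 16 * real n"
      using n(1) \<open>s ^ 4 = real r\<close> by (simp add: power4_eq_xxxx power2_eq_square mult_ac)
    moreover have "4 * s\<^sup>2 \<le> s\<^sup>2 * s\<^sup>2"
      using power_mono[OF \<open>s \<ge> 2\<close>, of 2] by (intro mult_right_mono) auto
    ultimately show "s\<^sup>2 / 4 * (2 / real n) \<le> 2 / 7"
      using n(2) by (simp add: field_simps)
    show "s / s\<^sup>2 \<le> 1 / 2"
      using \<open>s \<ge> 2\<close> by (simp add: power2_eq_square)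
  qed
  \<comment> \<open>The complement has probability at least \<open>1 - 11 / 14 = 3 / 14\<close>.
    Outside \<open>A j\<close> the error is at least \<open>\<tau> * r / 4\<close>, so a Markov-type
    bound gives risk \<open>\<tau> * r / 20\<close>.\<close>
  finally have "1 / 5 \<le> measure (distr N N sh) (space N - A j)"
    using Q.prob_compl[of "A j"] A by simp
  then have "\<tau> * real r / 4 * (1 / 5) \<le> \<tau> * real r / 4 * measure (distr N N sh) (space N - A j)"
    using \<tau> by (intro mult_left_mono) auto
  then have "ennreal (\<tau> * real r / 4 * (1 / 5)) \<le> ennreal (\<tau> * real r / 4 * measure (distr N N sh) (space N - A j))"
    by (rule ennreal_leI)
  also have "\<dots> = ennreal (\<tau> * real r / 4) * emeasure (distr N N sh) (space N - A j)"
    unfolding Q.emeasure_eq_measure using \<tau> by (intro ennreal_mult) auto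
  also have "\<dots> = (\<integral>\<^sup>+ y. ennreal (\<tau> * real r / 4) * indicator (space N - A j) y \<partial>distr N N sh)"
    by (subst nn_integral_cmult_indicator) auto
  also have "\<dots> = (\<integral>\<^sup>+ y. ennreal (\<tau> * real r / 4) * indicator (space N - A j) (sh y) \<partial>N)"
    by (subst nn_integral_distr[OF sh]) auto
  also have "\<dots> \<le> risk r m T \<sigma> u Ghat (g j)"
    unfolding risk_def N_def[symmetric]
  proof (intro nn_integral_mono)
    fix y assume "y \<in> space N"
    have obs: "observations r m T u (g j) y = sh y"
      by (simp add: observations_def sh_def)
    show "ennreal (\<tau> * real r / 4) * indicator (space N - A j) (sh y)
        \<le> ennreal (hinf_norm r (\<lambda>k. Ghat (observations r m T u (g j) y) k - g j k))"
    proof (cases "sh y \<in> space N - A j")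
      case True
      then obtain l where "\<tau> * real r / 4 \<le> \<bar>R l (Ghat (sh y)) - R l (g j)\<bar>"
        by (auto simp: A_def not_less)
      also have "R l (Ghat (sh y)) - R l (g j) = (\<Sum>k<r. (Ghat (sh y) k - g j k) * cos (2 * pi * real l * real k / real r))"
        by (simp add: R_def sum_subtractf left_diff_distrib)
      also have "\<bar>\<dots>\<bar> \<le> hinf_norm r (\<lambda>k. Ghat (sh y) k - g j k)"
        by (rule abs_cos_functional_le_hinf_norm)
      finally show ?thesis
        using True by (simp add: obs ennreal_leI)
    qed simp
  qed
  finally show ?thesis
    by (intro bexI[of _ "g j"]) (auto simp: fir_filters_def g_def)
qed

theorem theorem1p4:
  "\<exists>C::real. C > 0 \<and>
     (\<forall>(p::ennreal) (r::nat) (\<sigma>::real) (T::nat) (m::nat) (u::nat \<Rightarrow> nat \<Rightarrow> real).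
        1 \<le> p \<longrightarrow> 16 \<le> r \<longrightarrow> 0 < \<sigma> \<longrightarrow> T = 2 * r \<longrightarrow> 1 \<le> m \<longrightarrow>
        (\<forall>i\<in>{1..m}. lp_norm p T (u i) \<le> 1) \<longrightarrow>
        (INF Ghat\<in>estimators r m T. SUP g\<in>fir_filters r. risk r m T \<sigma> u Ghat g)
          \<ge> ennreal (C * \<sigma> *
               sqrt (real r powr enn2real (2 / max p 2) * ln (real r) / real m)))"
\<comment> \<open>The 20 comes from the risk bound for one codeword, the 40 from the amplitude
  \<open>\<tau>\<close> below.\<close>
proof (intro exI[of _ "sqrt (1 / 40) / 20"] conjI allI impI)
  fix p :: ennreal and r :: nat and \<sigma> :: real and T m :: nat and u :: "nat \<Rightarrow> nat \<Rightarrow> real"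
  assume p: "1 \<le> p" and r: "16 \<le> r" and \<sigma>: "0 < \<sigma>" and T: "T = 2 * r" and m: "1 \<le> m"
    and u: "\<forall>i\<in>{1..m}. lp_norm p T (u i) \<le> 1"
  define \<theta> where "\<theta> = enn2real (2 / max p 2)"
  define x where "x = real r powr \<theta>"
  \<comment> \<open>With \<open>T = 2 * r\<close> and \<open>\<theta> \<ge> 0\<close>, the energy
    bound \<open>T powr (1 - \<theta>)\<close> is at most \<open>2 * r / x\<close>.\<close>
  define S where "S = 2 * (real r / x)"
  \<comment> \<open>The largest amplitude that the energy constraint allows: the 40 makes it hold
    with equality.\<close>
  define \<tau> where "\<tau> = \<sigma> * sqrt (x * ln (real r) / (40 * real m)) / real r"
  have "\<theta> \<ge> 0"
    by (simp add: \<theta>_def)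
  have pos: "x > 0" "ln (real r) > 0" "real r > 0" "real m > 0"
    using r m by (auto simp: x_def)
  have S: "(\<Sum>k<T. (u i k)\<^sup>2) \<le> S" if "i \<in> {1..m}" for i
  proof -
    have "(\<Sum>k<T. (u i k)\<^sup>2) \<le> real T powr (1 - \<theta>)"
      unfolding \<theta>_def using u that p r T by (intro sum_sq_le_of_lp_norm_le_1) auto
    also have "\<dots> = 2 powr (1 - \<theta>) * (real r powr (1 - \<theta>))"
      by (simp add: T powr_mult)
    also have "\<dots> \<le> 2 powr 1 * (real r powr (1 - \<theta>))"
      using \<open>\<theta> \<ge> 0\<close> by (intro mult_right_mono powr_mono) auto
    finally show ?thesis
      using pos by (simp add: S_def x_def powr_diff)
  qed
  have "5 * (real m * \<tau>\<^sup>2 * real r * S / \<sigma>\<^sup>2) = ln (real r) / 4"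
    using pos \<sigma> by (simp add: \<tau>_def S_def power_mult_distrib power_divide field_simps power2_eq_square)
  then have "\<exists>g\<in>fir_filters r. ennreal (\<tau> * real r / 20) \<le> risk r m T \<sigma> u Ghat g"
    if "Ghat \<in> estimators r m T" for Ghat
    using pos by (intro exists_filter_risk_ge[OF r \<sigma> _ m _ S _ that]) (auto simp: \<tau>_def S_def \<sigma>)
  moreover have "\<tau> * real r / 20 = sqrt (1 / 40) / 20 * \<sigma> * sqrt (x * ln (real r) / real m)"
    using pos by (simp add: \<tau>_def real_sqrt_divide real_sqrt_mult)
  ultimately show "ennreal (sqrt (1 / 40) / 20 * \<sigma> * sqrt (real r powr enn2real (2 / max p 2) * ln (real r) / real m))
      \<le> (INF Ghat\<in>estimators r m T. SUP g\<in>fir_filters r. risk r m T \<sigma> u Ghat g)"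
    unfolding \<theta>_def[symmetric] x_def[symmetric]
    by (intro INF_greatest) (metis SUP_upper order_trans)
qed simp

end
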